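(* Let $p>3$ be a prime and $n>2$ an integer, and suppose that $R=p2^n+1$ is composite and satisfies $$3^{\frac{R-1}{2}}\equiv -1 \pmod R.$$ Then every factor $f>1$ of $R$ is of the form $f=k2^n+1$ for some positive integer $k$, and moreover $f$ is primover to base $3$ and $O_f(3)=2^n$.
   Context: For an integer $d>1$ coprime to $3$, $O_d(3)$ denotes the multiplicative order of $3$ modulo $d$. A composite integer $N$ coprime to $3$ is called an overpseudoprime to base $3$ if $O_d(3)=O_N(3)$ for every divisor $d>1$ of $N$. An integer $N>1$ coprime to $3$ is called primover to base $3$ if it is either prime or an overpseudoprime to base $3$. *)

theory Defs
  imports "HOL-Number_Theory.Number_Theory"
begin

text \<open>The multiplicative order \<open>O_d(b)\<close> is the library's \<^term>\<open>ord d b\<close>: the modulus comes first.\<close>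

definition composite :: "nat \<Rightarrow> bool" where
  "composite N \<longleftrightarrow> N > 1 \<and> \<not> prime N"

definition overpseudoprime :: "nat \<Rightarrow> nat \<Rightarrow> bool" where
  "overpseudoprime b N \<longleftrightarrow>
     composite N \<and> coprime N b \<and> (\<forall>d. d dvd N \<and> d > 1 \<longrightarrow> ord d b = ord N b)"

definition primover :: "nat \<Rightarrow> nat \<Rightarrow> bool" where
  "primover b N \<longleftrightarrow> N > 1 \<and> coprime N b \<and> (prime N \<or> overpseudoprime b N)"

end

theory Submission
  imports Defs
begin

text \<open>
  The congruence descends to every divisor \<open>f > 1\<close> of the odd number \<open>R\<close>, so the order of \<open>3\<close>
  modulo \<open>f\<close> divides \<open>p * 2 ^ n\<close> but not \<open>p * 2 ^ (n - 1)\<close>, and hence is \<open>2 ^ n\<close> or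
  \<open>p * 2 ^ n = R - 1\<close>. The latter would give \<open>R - 1 \<le> totient f \<le> f - 1\<close>, whence \<open>f = R\<close> and
  \<open>totient R = R - 1\<close>, making \<open>R\<close> prime. So all these orders are \<open>2 ^ n\<close>; every prime factor of
  \<open>R\<close> is then \<open>1\<close> modulo \<open>2 ^ n\<close>, and so is every divisor.
\<close>

text \<open>An even cofactor of \<open>d\<close> could be halved, making \<open>d\<close> divide
  \<open>p * 2 ^ (n - 1)\<close>. So the cofactor is odd, \<open>d\<close> absorbs the full power of
  2, and what remains of \<open>d\<close> divides \<open>p\<close>.\<close>

lemma dvd_prime_times_two_power_cases:
  fixes p n d :: nat
  assumes "prime p" "n > 0" and dvd: "d dvd p * 2 ^ n" and ndvd: "\<not> d dvd p * 2 ^ (n - 1)"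
  shows "d = 2 ^ n \<or> d = p * 2 ^ n"
proof -
  obtain e where e: "p * 2 ^ n = d * e"
    using dvd by blast
  have "odd e"
  proof
    assume "even e"
    then obtain e' where "e = 2 * e'" by blast
    moreover have "(2::nat) ^ n = 2 * 2 ^ (n - 1)"
      using \<open>n > 0\<close> by (simp flip: power_Suc)
    ultimately have "p * 2 ^ (n - 1) = d * e'"
      using e by simp
    with ndvd show False by simp
  qed
  then have "coprime (2 ^ n) e"
    by simp
  moreover have "2 ^ n dvd d * e"
    by (simp flip: e)
  ultimately have "2 ^ n dvd d"
    by (simp add: coprime_dvd_mult_left_iff)
  then obtain c where c: "d = 2 ^ n * c" by blast
  with e have "p = c * e" by simp
  then have "c dvd p" by simp
  with \<open>prime p\<close> have "c = 1 \<or> c = p"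
    using prime_nat_iff by blast
  with c show ?thesis by auto
qed

lemma ord_le_pred:
  fixes f a :: nat
  assumes "f > 1"
  shows "ord f a \<le> f - 1"
proof (cases "coprime f a")
  case True
  then have "ord f a \<le> totient f"
    using assms by (intro dvd_imp_le order_divides_totient) auto
  with totient_less[of f] assms show ?thesis by simp
\<comment> \<open>Without coprimality, \<open>ord f a\<close> has the default value 0.\<close>
qed simp

lemma ord_eq_pred_imp_prime:
  fixes f a :: nat
  assumes "f > 1" "ord f a = f - 1"
  shows "prime f"
proof -
  \<comment> \<open>The order \<open>f - 1\<close> is positive, hence not the default value
    0.\<close>
  have "coprime f a"
    using assms by (metis ord_eq_0 zero_less_diff less_irrefl)
  then have "f - 1 \<le> totient f"
    using assms by (metis dvd_imp_le order_divides_totient totient_gt_0_iff zero_less_one order_less_trans)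
  with totient_less[of f] assms have "totient f = f - 1" by simp
  with assms show ?thesis by (intro totient_imp_prime) auto
qed

text \<open>Residues equal to 1 are closed under products, so the prime factorization of
  \<open>f\<close> suffices.\<close>

lemma cong_1_if_prime_factors_cong_1:
  fixes f m :: nat
  assumes "f > 0" "\<And>q. prime q \<Longrightarrow> q dvd f \<Longrightarrow> [q = 1] (mod m)"
  shows "[f = 1] (mod m)"
proof -
  have "[(\<Prod>q\<in>prime_factors f. q ^ multiplicity q f) = (\<Prod>q\<in>prime_factors f. 1)] (mod m)"
  proof (rule cong_prod)
    fix q assume "q \<in> prime_factors f"
    then have "[q = 1] (mod m)"
      using assms by auto
    then show "[q ^ multiplicity q f = 1] (mod m)"
      by (metis cong_pow power_one)
  qed
  then show ?thesis
    using prod_prime_factors[of f] \<open>f > 0\<close> by simp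
qed

theorem mainTheorem3:
  fixes p n R :: nat
  assumes "prime p" and "p > 3" and "n > 2"
    and "R = p * 2 ^ n + 1"
    and "composite R"
    and "[3 ^ ((R - 1) div 2) = -1] (mod int R)"
  shows "\<forall>f::nat. f dvd R \<and> f > 1 \<longrightarrow>
           (\<exists>k::nat. k > 0 \<and> f = k * 2 ^ n + 1) \<and> primover 3 f \<and> ord f 3 = 2 ^ n"
proof -
  \<comment> \<open>This is the exponent \<open>(R - 1) div 2\<close>, in the shape that the case
    lemma on divisors expects.\<close>
  define h where "h = p * 2 ^ (n - 1)"
  have h: "p * 2 ^ n = 2 * h"
    using \<open>n > 2\<close> unfolding h_def by (cases n) auto
  \<comment> \<open>Kept general in \<open>f\<close>: it serves below for \<open>f\<close> itself,
    its prime factors and all its divisors.\<close>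
  have ord: "ord f 3 = 2 ^ n" if f: "f dvd R" "f > 1" for f :: nat
  proof -
    have "[3 ^ h = -1] (mod int R)"
      using assms(6) h \<open>R = _\<close> by simp
    then have neg: "[3 ^ h = -1] (mod int f)"
      by (rule cong_dvd_modulus) (use f in simp)
    have "odd R"
      using h \<open>R = _\<close> by simp
    with f have "odd f"
      using dvd_trans by blast
    \<comment> \<open>Modulo 2 the residues 1 and -1 would coincide.\<close>
    with f have "f > 2" by (cases "f = 2") auto
    have "[(3 ^ h) ^ 2 = (-1) ^ 2] (mod int f)"
      using neg by (rule cong_pow)
    then have "[int (3 ^ (2 * h)) = int 1] (mod int f)"
      by (simp add: power_mult[symmetric] mult.commute)
    then have dvd: "ord f 3 dvd p * 2 ^ n"
      unfolding cong_int_iff ord_divides h .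
    have ndvd: "\<not> ord f 3 dvd h"
    proof
      assume "ord f 3 dvd h"
      then have "[int (3 ^ h) = int 1] (mod int f)"
        unfolding cong_int_iff ord_divides .
      with neg have "[1 = -1] (mod int f)"
        by (metis cong_sym cong_trans of_nat_1 of_nat_numeral of_nat_power)
      then have "int f dvd 2"
        by (simp add: cong_iff_dvd_diff)
      then have "int f \<le> 2"
        by (rule zdvd_imp_le) simp
      with \<open>f > 2\<close> show False by simp
    qed
    have "ord f 3 \<noteq> p * 2 ^ n"
    proof
      assume eq: "ord f 3 = p * 2 ^ n"
      then have "R \<le> f"
        using ord_le_pred[of f 3] f \<open>R = _\<close> by linarith
      moreover have "f \<le> R"
        using f \<open>R = _\<close> by (intro dvd_imp_le) auto
      ultimately have "f = R" by simp
      with eq f have "prime R"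
        using ord_eq_pred_imp_prime[of f 3] \<open>R = _\<close> by simp
      with \<open>composite R\<close> show False
        by (simp add: composite_def)
    qed
    with dvd_prime_times_two_power_cases[OF \<open>prime p\<close> _ dvd] ndvd \<open>n > 2\<close> show ?thesis
      unfolding h_def by auto
  qed
  show ?thesis
  proof (intro allI impI; elim conjE)
    fix f :: nat
    assume f: "f dvd R" "f > 1"
    have "[f = 1] (mod 2 ^ n)"
    proof (rule cong_1_if_prime_factors_cong_1)
      fix q :: nat
      assume q: "prime q" "q dvd f"
      then have "ord q 3 = 2 ^ n"
        using f prime_gt_1_nat[of q] by (intro ord) (auto intro: dvd_trans)
      \<comment> \<open>The order is nonzero, so \<open>q\<close> is coprime to 3 and Euler's
        theorem applies.\<close>
      then have "2 ^ n dvd totient q"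
        using order_divides_totient[of q 3] ord_eq_0[of q 3] by simp
      with q show "[q = 1] (mod 2 ^ n)"
        by (simp add: totient_prime cong_altdef_nat prime_gt_0_nat Suc_leI)
    qed (use f in simp)
    then have "2 ^ n dvd f - 1"
      using f by (simp add: cong_altdef_nat)
    then obtain k where "f - 1 = k * 2 ^ n"
      by (metis dvdE mult.commute)
    then have k: "f = k * 2 ^ n + 1"
      using f by linarith
    have "k > 0"
      using k f by (cases k) auto
    have "coprime f 3"
      using ord[OF f] ord_eq_0[of f 3] by simp
    \<comment> \<open>Divisors of \<open>f\<close> divide \<open>R\<close>, so they all share the
      order \<open>2 ^ n\<close>; this settles the case of composite \<open>f\<close>.\<close>
    moreover have "\<forall>d. d dvd f \<and> d > 1 \<longrightarrow> ord d 3 = ord f 3"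
      using ord f by (auto intro: dvd_trans)
    ultimately have "primover 3 f"
      unfolding primover_def overpseudoprime_def composite_def using f by blast
    with k \<open>k > 0\<close> ord[OF f] show "(\<exists>k::nat. k > 0 \<and> f = k * 2 ^ n + 1) \<and> primover 3 f \<and> ord f 3 = 2 ^ n"
      by blast
  qed
qed

end
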